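(* Let $p\geq 1$ be an integer, $q\in(0,1)$, $\mu>-1$, $-1\leq B<A\leq 1$ and $\eta>-p$. Let $f(z)=z^p+\sum_{n=1}^{\infty}a_{n+p}z^{n+p}$ belong to $\mathcal{S}_p^{\ast}(q,\mu,A,B)$, and let $F_{\eta,p}$ be the $q$-Bernardi integral of $f$, written as $F_{\eta,p}(z)=z^p+\sum_{n=1}^{\infty}b_{n+p}z^{n+p}$. Then for every $\sigma\in\mathbb{C}$, $$|b_{p+2}-\sigma b_{p+1}^2|\leq\frac{[\eta+p,q]}{[\eta+p+2,q]}\,\frac{(A-B)\psi_2}{\Lambda_{p+2}}\max\{1,|\upsilon|\},$$ where $$\upsilon=\bigl(B-(A-B)\psi_1\bigr)+\frac{\Lambda_{p+2}\psi_1^2}{\Lambda_{p+1}^2\psi_2}(A-B)\frac{[\eta+p,q][\eta+p+2,q]}{[\eta+p+1,q]^2}\sigma .$$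
   Context: Let $\mathbb{D}=\{z\in\mathbb{C}:|z|<1\}$. For an integer $p\ge 1$, $\mathfrak{A}_p$ is the set of functions analytic in $\mathbb{D}$ of the form $f(z)=z^p+\sum_{n=1}^\infty a_{n+p}z^{n+p}$. For $q\in(0,1)$ and real $x$, $[x,q]=\frac{1-q^x}{1-q}$; for integers $n\ge1$, $[n,q]!=[1,q][2,q]\cdots[n,q]$ and $[0,q]!=1$; for $x>0$, $[x,q]_0=1$ and $[x,q]_n=[x,q][x+1,q]\cdots[x+n-1,q]$ for $n\ge 1$. For $\mu>-1$ put $\Lambda_{n+p}=\frac{[\mu+1,q]_{n+p}}{[n+p,q]!}$, and for $n\ge1$ put $\psi_n=\frac{[p,q]}{[n+p,q]-[p,q]}$. The $q$-derivative is $\partial_q f(z)=\frac{f(z)-f(qz)}{z(1-q)}$ for $z\ne0$, so that it acts on power series termwise by $\partial_q z^m=[m,q]z^{m-1}$. The operator $\mathcal{L}_q^{\mu+p-1}:\mathfrak{A}_p\to\mathfrak{A}_p$ is $\mathcal{L}_q^{\mu+p-1}f(z)=z^p+\sum_{n=1}^\infty \Lambda_{n+p}a_{n+p}z^{n+p}$. For $g,h$ analytic in $\mathbb{D}$, $g\prec h$ (subordination) means there is an analytic $w$ on $\mathbb{D}$ with $w(0)=0$, $|w(z)|<1$ and $g(z)=h(w(z))$ for all $z\in\mathbb{D}$. For $q\in(0,1)$, $\mu>-1$ and $-1\le B<A\le1$, the class $\mathcal{S}_p^{\ast}(q,\mu,A,B)$ consists of all $f\in\mathfrak{A}_p$ such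 that $$\frac{z\,\partial_q\mathcal{L}_q^{\mu+p-1}f(z)}{[p,q]\,\mathcal{L}_q^{\mu+p-1}f(z)}\prec\frac{1+Az}{1+Bz},$$ where the quotient on the left is understood to take the value $1$ at $z=0$. For $\eta>-p$ and $f\in\mathfrak{A}_p$, the $q$-Bernardi integral of $f$ is $$F_{\eta,p}(z)=\frac{[\eta+p,q]}{z^\eta}\int_0^z t^{\eta-1}f(t)\,d_qt=z^p+\sum_{n=1}^\infty\frac{[\eta+p,q]}{[\eta+p+n,q]}a_{n+p}z^{n+p},\quad z\in\mathbb{D},$$ where $\int_0^z g(t)\,d_qt=(1-q)z\sum_{k=0}^\infty q^kg(q^kz)$ is the Jackson $q$-integral; the power series may be taken as the definition. *)

theory Defs
  imports "HOL-Complex_Analysis.Complex_Analysis"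
begin

abbreviation unit_disc :: "complex set"  ("\<D>")
  where "\<D> \<equiv> ball 0 1"

definition qnum :: "real \<Rightarrow> real \<Rightarrow> real"
  where "qnum q x = (1 - q powr x) / (1 - q)"

definition qfact :: "real \<Rightarrow> nat \<Rightarrow> real"
  where "qfact q n = (\<Prod>k=1..n. qnum q (real k))"

definition qpoch :: "real \<Rightarrow> real \<Rightarrow> nat \<Rightarrow> real"
  where "qpoch q x n = (\<Prod>k<n. qnum q (x + real k))"

text \<open>The argument \<open>m\<close> is the full index, i.e. \<open>m = n + p\<close>.\<close>
definition Lam :: "real \<Rightarrow> real \<Rightarrow> nat \<Rightarrow> real"
  where "Lam q \<mu> m = qpoch q (\<mu> + 1) m / qfact q m"

definition psi :: "nat \<Rightarrow> real \<Rightarrow> nat \<Rightarrow> real"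
  where "psi p q n = qnum q (real p) / (qnum q (real (n + p)) - qnum q (real p))"

text \<open>\<open>f(z) = z\<^sup>p + (\<Sum>n\<ge>1. a (n + p) z\<^bsup>n + p\<^esup>)\<close> on the unit disc; the values of \<open>a\<close> at
  indices up to \<open>p\<close> are irrelevant.\<close>
definition p_expansion :: "nat \<Rightarrow> (nat \<Rightarrow> complex) \<Rightarrow> (complex \<Rightarrow> complex) \<Rightarrow> bool"
  where "p_expansion p a f \<longleftrightarrow>
    (\<forall>z\<in>\<D>. (\<lambda>n. a (Suc n + p) * z ^ (Suc n + p)) sums (f z - z ^ p))"

definition class_A :: "nat \<Rightarrow> (complex \<Rightarrow> complex) set"
  where "class_A p = {f. f holomorphic_on \<D> \<and> (\<exists>a. p_expansion p a f)}"

abbreviation coef :: "(complex \<Rightarrow> complex) \<Rightarrow> nat \<Rightarrow> complex"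
  where "coef f n \<equiv> fps_nth (fps_expansion f 0) n"

text \<open>The value at \<open>0\<close> agrees with the termwise action \<open>z\<^sup>m \<mapsto> [m, q] z\<^bsup>m - 1\<^esup>\<close> on power series.\<close>
definition qderiv :: "real \<Rightarrow> (complex \<Rightarrow> complex) \<Rightarrow> complex \<Rightarrow> complex"
  where "qderiv q f z =
    (if z = 0 then deriv f 0 else (f z - f (of_real q * z)) / (z * (1 - of_real q)))"

definition L_op :: "nat \<Rightarrow> real \<Rightarrow> real \<Rightarrow> (complex \<Rightarrow> complex) \<Rightarrow> complex \<Rightarrow> complex"
  where "L_op p q \<mu> f z =
    z ^ p + (\<Sum>n. of_real (Lam q \<mu> (Suc n + p)) * coef f (Suc n + p) * z ^ (Suc n + p))"

definition subordinate :: "(complex \<Rightarrow> complex) \<Rightarrow> (complex \<Rightarrow> complex) \<Rightarrow> bool"  (infix "\<prec>\<^sub>s" 50)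
  where "g \<prec>\<^sub>s h \<longleftrightarrow> g holomorphic_on \<D> \<and> h holomorphic_on \<D> \<and>
    (\<exists>w. w holomorphic_on \<D> \<and> w 0 = 0 \<and> (\<forall>z\<in>\<D>. norm (w z) < 1) \<and> (\<forall>z\<in>\<D>. g z = h (w z)))"

text \<open>The convention \<open>x / 0 = 0\<close> admits no extra functions. If \<open>g = L_op p q \<mu> f\<close> had a zero
  \<open>z \<noteq> 0\<close> in the disc, then, since its zeros do not accumulate at \<open>0\<close>, some zero \<open>q\<^sup>k z\<close> of \<open>g\<close>
  would have \<open>g (q\<^bsup>k + 1\<^esup> z) \<noteq> 0\<close>; the quotient would be unbounded near that zero, hence not
  holomorphic.\<close>
definition class_S ::
    "nat \<Rightarrow> real \<Rightarrow> real \<Rightarrow> real \<Rightarrow> real \<Rightarrow> (complex \<Rightarrow> complex) set"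
  where "class_S p q \<mu> A B = {f \<in> class_A p.
    (\<lambda>z. if z = 0 then 1
         else z * qderiv q (L_op p q \<mu> f) z / (of_real (qnum q (real p)) * L_op p q \<mu> f z))
    \<prec>\<^sub>s (\<lambda>z. (1 + of_real A * z) / (1 + of_real B * z))}"

text \<open>The power series form of the Jackson integral
  \<open>[\<eta> + p, q] z\<^bsup>-\<eta>\<^esup> \<integral> t\<^bsup>\<eta> - 1\<^esup> f(t) d\<^sub>qt\<close> from \<open>0\<close> to \<open>z\<close>.\<close>
definition q_bernardi :: "nat \<Rightarrow> real \<Rightarrow> real \<Rightarrow> (complex \<Rightarrow> complex) \<Rightarrow> complex \<Rightarrow> complex"
  where "q_bernardi p q \<eta> f z =
    z ^ p + (\<Sum>n. of_real (qnum q (\<eta> + real p) / qnum q (\<eta> + real p + real (Suc n)))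
                   * coef f (Suc n + p) * z ^ (Suc n + p))"

end

theory Submission
  imports Defs
begin

text \<open>
  Let \<open>g\<close> be the image of \<open>f\<close> under the operator of the class, with coefficients
  \<open>g\<^sub>1, g\<^sub>2\<close> at \<open>z\<^bsup>p+1\<^esup>, z\<^bsup>p+2\<^esup>\<close>. Clearing denominators in the subordination gives a Schwarz
  function \<open>w = w\<^sub>1 z + w\<^sub>2 z\<^sup>2 + \<dots>\<close> with
  \<open>z \<partial>\<^sub>q g (1 + B w) = [p,q] g (1 + A w)\<close>.
  The \<open>q\<close>-derivative multiplies the coefficient of \<open>z\<^sup>m\<close> by \<open>[m,q]\<close>, so the terms of degrees
  \<open>p + 1\<close> and \<open>p + 2\<close> give (\<open>coefficients_from_subordination\<close>)
  \<open>g\<^sub>1 = (A - B) \<psi>\<^sub>1 w\<^sub>1\<close> and \<open>g\<^sub>2 = (A - B) \<psi>\<^sub>2 (w\<^sub>2 - (B - (A - B) \<psi>\<^sub>1) w\<^sub>1\<^sup>2)\<close>.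
  Both the operator and the Bernardi integral only rescale coefficients, so
  \<open>b\<^bsub>p+2\<^esub> - \<sigma> b\<^bsub>p+1\<^esub>\<^sup>2\<close> is the constant of the claimed bound times \<open>w\<^sub>2 - \<upsilon> w\<^sub>1\<^sup>2\<close>. The
  Schwarz--Pick inequality \<open>\<bar>w\<^sub>2\<bar> \<le> 1 - \<bar>w\<^sub>1\<bar>\<^sup>2\<close> then bounds the last factor by a convex
  combination of \<open>1\<close> and \<open>\<bar>\<upsilon>\<bar>\<close> (\<open>Schwarz_function_Fekete_Szego\<close>).

  Only finitely many coefficients at \<open>0\<close> matter, so every series identity is needed only on some
  neighbourhood of \<open>0\<close>. For the operator series a geometric bound on its multipliers therefore
  suffices, which \<open>Lam_le_power\<close> supplies.
\<close>

section \<open>Two coefficients of a Schwarz function\<close>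

text \<open>
  Write \<open>w z = z * h z\<close>, so that \<open>w\<^sub>1\<close> and \<open>w\<^sub>2\<close> are the first two coefficients of \<open>h\<close>. By the
  Schwarz lemma \<open>h\<close> is a unimodular constant, and then \<open>w\<^sub>2 = 0\<close>, or it maps the disc to itself.
  In the second case the Schwarz lemma applies once more, to \<open>h\<close> followed by the disc automorphism
  that sends \<open>h 0\<close> to \<open>0\<close>; the derivative of this composite at \<open>0\<close> is \<open>w\<^sub>2 / (1 - \<bar>w\<^sub>1\<bar>\<^sup>2)\<close>.
\<close>
lemma Schwarz_Pick_second_coefficient:
  assumes holw: "w holomorphic_on \<D>" and w0: "w 0 = 0"
    and w_lt: "\<And>z. norm z < 1 \<Longrightarrow> norm (w z) < 1"
  shows "norm (coef w 2) \<le> 1 - (norm (coef w 1))\<^sup>2"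
proof -
  have expand: "g has_fps_expansion fps_expansion g 0" if "g holomorphic_on \<D>" for g
    using has_fps_expansion_fps_expansion[of \<D> g] that by simp
  obtain h where holh: "h holomorphic_on \<D>"
    and wh: "\<And>z. norm z < 1 \<Longrightarrow> w z = z * h z" and dw: "deriv w 0 = h 0"
    using Schwarz3[OF holw w0] by blast
  define H where "H = fps_expansion h 0"
  have H: "h has_fps_expansion H" and W: "w has_fps_expansion fps_expansion w 0"
    using expand holh holw by (auto simp: H_def)
  have near: "\<forall>\<^sub>F z in nhds (0::complex). norm z < 1"
    using eventually_nhds_in_open[of \<D> 0] by simp
  have "(\<lambda>z. z * h z) has_fps_expansion fps_X * H"
    by (intro fps_expansion_intros H)
  moreover have "\<forall>\<^sub>F z in nhds 0. z * h z = w z"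
    using near by eventually_elim (simp add: wh)
  ultimately have "w has_fps_expansion fps_X * H"
    using has_fps_expansion_cong[OF _ refl, of "\<lambda>z. z * h z" w] by blast
  then have WH: "fps_expansion w 0 = fps_X * H"
    using fps_expansion_unique_complex W by blast
  have w1: "coef w 1 = h 0" and w2: "coef w 2 = fps_nth H 1"
    using has_fps_expansion_imp_0_eq_fps_nth_0[OF H] by (simp_all add: WH)
  note Schwarz = Schwarz_Lemma[OF holw w0 w_lt]
  have h0_le: "norm (h 0) \<le> 1"
    using Schwarz(2)[of 0] dw by simp
  show ?thesis
  proof (cases "norm (h 0) = 1")
    case True
    then obtain \<alpha> where \<alpha>: "\<And>z. norm z < 1 \<Longrightarrow> w z = \<alpha> * z"
      using Schwarz(3)[of 0] dw by auto
    have "(\<lambda>z. \<alpha> * z) has_fps_expansion fps_const \<alpha> * fps_X"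
      by (intro fps_expansion_intros)
    moreover have "\<forall>\<^sub>F z in nhds 0. \<alpha> * z = w z"
      using near by eventually_elim (simp add: \<alpha>)
    ultimately have "w has_fps_expansion fps_const \<alpha> * fps_X"
      using has_fps_expansion_cong[OF _ refl, of "\<lambda>z. \<alpha> * z" w] by blast
    then have "fps_expansion w 0 = fps_const \<alpha> * fps_X"
      using fps_expansion_unique_complex W by blast
    then have "coef w 2 = 0" by simp
    then show ?thesis using True w1 by simp
  next
    case False
    then have h0: "norm (h 0) < 1" using h0_le by simp
    have h_lt: "norm (h z) < 1" if z: "norm z < 1" for z
    proof (cases "z = 0")
      case z0: False
      have "norm (w z) \<le> norm z" using Schwarz(1) z by blast
      moreover have "norm (w z) \<noteq> norm z"
      proof
        assume "norm (w z) = norm z"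
        then obtain \<alpha> where \<alpha>: "\<And>u. norm u < 1 \<Longrightarrow> w u = \<alpha> * u" "norm \<alpha> = 1"
          using Schwarz(3)[of 0] z z0 by auto
        have "deriv w 0 = deriv (\<lambda>u. \<alpha> * u) 0"
          using near by (intro deriv_cong_ev refl) (auto elim!: eventually_mono simp: \<alpha>)
        then show False using False dw \<alpha> by simp
      qed
      ultimately show ?thesis
        using z0 wh[OF z] by (simp add: norm_mult)
    qed (use h0 in simp)
    define m where "m = (\<lambda>z. Moebius_function 0 (h 0) (h z))"
    have "h ` \<D> \<subseteq> \<D>" using h_lt by auto
    then have holm: "m holomorphic_on \<D>"
      using holomorphic_on_compose_gen[OF holh Moebius_function_holomorphic[OF h0, of 0]]
      by (simp add: m_def o_def)
    have m0: "m 0 = 0" by (simp add: m_def Moebius_function_eq_zero)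
    have m_lt: "norm (m z) < 1" if "norm z < 1" for z
      using Moebius_function_norm_lt_1[OF h0 h_lt[OF that]] by (simp add: m_def)
    have dm: "norm (deriv m 0) \<le> 1"
      using Schwarz_Lemma(2)[OF holm m0 m_lt, of 0] by simp
    define M where "M = fps_expansion m 0"
    have M: "m has_fps_expansion M" using expand holm by (simp add: M_def)
    have M0: "fps_nth M 0 = 0" using m0 by (simp add: M_def fps_expansion_def)
    have M1: "fps_nth M 1 = deriv m 0" by (simp add: M_def fps_expansion_def)
    \<comment> \<open>The derivative of \<open>m\<close> is read off from \<open>m * (1 - cnj (h 0) * h) = h - h 0\<close> in degree \<open>1\<close>,
      where \<open>m 0 = 0\<close> leaves a single term on the left.\<close>
    have "(\<lambda>z. m z * (1 - cnj (h 0) * h z)) has_fps_expansion M * (1 - fps_const (cnj (h 0)) * H)"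
      by (intro fps_expansion_intros M H)
    moreover have "m z * (1 - cnj (h 0) * h z) = h z - h 0" if z: "norm z < 1" for z
    proof -
      have "norm (cnj (h 0) * h z) < 1"
        using mult_strict_mono'[OF h0 h_lt[OF z]] by (simp add: norm_mult)
      then have "1 - cnj (h 0) * h z \<noteq> 0" by auto
      then show ?thesis by (simp add: m_def Moebius_function_simple)
    qed
    then have "\<forall>\<^sub>F z in nhds 0. m z * (1 - cnj (h 0) * h z) = h z - h 0"
      using near by (auto elim!: eventually_mono)
    ultimately have "(\<lambda>z. h z - h 0) has_fps_expansion M * (1 - fps_const (cnj (h 0)) * H)"
      using has_fps_expansion_cong[OF _ refl, of "\<lambda>z. m z * (1 - cnj (h 0) * h z)"
          "\<lambda>z. h z - h 0"] by blast
    moreover have "(\<lambda>z. h z - h 0) has_fps_expansion H - fps_const (h 0)"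
      by (intro fps_expansion_intros H)
    ultimately have "M * (1 - fps_const (cnj (h 0)) * H) = H - fps_const (h 0)"
      using fps_expansion_unique_complex by blast
    then have "fps_nth (M * (1 - fps_const (cnj (h 0)) * H)) 1 = fps_nth (H - fps_const (h 0)) 1"
      by simp
    then have "fps_nth M 1 * (1 - cnj (h 0) * h 0) = fps_nth H 1"
      using has_fps_expansion_imp_0_eq_fps_nth_0[OF H] by (simp add: fps_mult_nth M0)
    moreover have "1 - cnj (h 0) * h 0 = of_real (1 - (norm (h 0))\<^sup>2)"
      by (metis complex_norm_square mult.commute of_real_1 of_real_diff)
    ultimately have "norm (fps_nth H 1) = norm (deriv m 0) * \<bar>1 - (norm (h 0))\<^sup>2\<bar>"
      using M1 by (metis norm_mult norm_of_real)
    moreover have "(norm (h 0))\<^sup>2 \<le> 1" using h0_le by (simp add: power_le_one)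
    ultimately have "norm (fps_nth H 1) \<le> 1 - (norm (h 0))\<^sup>2"
      using mult_right_mono[OF dm, of "1 - (norm (h 0))\<^sup>2"] by simp
    then show ?thesis using w1 w2 by simp
  qed
qed

text \<open>
  With \<open>t = \<bar>w\<^sub>1\<bar>\<^sup>2\<close> in the unit interval, the Schwarz--Pick bound leaves the convex combination
  \<open>(1 - t) * 1 + t * \<bar>v\<bar>\<close>.
\<close>
lemma Schwarz_function_Fekete_Szego:
  assumes "w holomorphic_on \<D>" "w 0 = 0" "\<And>z. norm z < 1 \<Longrightarrow> norm (w z) < 1"
  shows "norm (coef w 2 - v * (coef w 1)\<^sup>2) \<le> max 1 (norm v)"
proof -
  define t where "t = (norm (coef w 1))\<^sup>2"
  have w2: "norm (coef w 2) \<le> 1 - t"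
    using Schwarz_Pick_second_coefficient[OF assms] by (simp add: t_def)
  then have t: "0 \<le> t" "0 \<le> 1 - t"
    using norm_ge_zero[of "coef w 2"] unfolding t_def by (simp, linarith)
  have "norm (coef w 2 - v * (coef w 1)\<^sup>2) \<le> norm (coef w 2) + norm v * t"
    using norm_triangle_ineq4[of "coef w 2" "v * (coef w 1)\<^sup>2"]
    by (simp add: t_def norm_mult norm_power)
  also have "\<dots> \<le> (1 - t) * max 1 (norm v) + t * max 1 (norm v)"
    using w2 t mult_left_mono[of 1 "max 1 (norm v)" "1 - t"]
      mult_left_mono[of "norm v" "max 1 (norm v)" t]
    by (simp add: mult.commute)
  also have "\<dots> = max 1 (norm v)" by (simp add: algebra_simps)
  finally show ?thesis .
qed

section \<open>Power series with leading term \<open>z\<^sup>p\<close>\<close>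

text \<open>
  The coefficients up to index \<open>p\<close> are overridden because a \<open>p\<close>-expansion says nothing about them.
\<close>
definition p_fps :: "nat \<Rightarrow> (nat \<Rightarrow> complex) \<Rightarrow> complex fps"
  where "p_fps p c = Abs_fps (\<lambda>n. if n < p then 0 else if n = p then 1 else c n)"

lemma p_fps_nth:
  "fps_nth (p_fps p c) n = (if n < p then 0 else if n = p then 1 else c n)"
  by (simp add: p_fps_def)

lemma p_fps_sums:
  assumes "(\<lambda>n. c (Suc n + p) * z ^ (Suc n + p)) sums s"
  shows "(\<lambda>n. fps_nth (p_fps p c) n * z ^ n) sums (z ^ p + s)"
proof -
  have "(\<lambda>n. fps_nth (p_fps p c) (n + Suc p) * z ^ (n + Suc p)) sums s"
    using assms by (simp add: p_fps_nth)
  moreover have "(\<Sum>i<Suc p. fps_nth (p_fps p c) i * z ^ i) = z ^ p"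
    by (simp add: p_fps_nth)
  ultimately show ?thesis
    using sums_iff_shift[of "\<lambda>n. fps_nth (p_fps p c) n * z ^ n" "Suc p" s]
    by (simp only: add.commute)
qed

lemma p_expansion_imp_has_fps_expansion:
  assumes "p_expansion p c f"
  shows "f has_fps_expansion p_fps p c"
proof (rule has_fps_expansionI)
  have "(\<lambda>n. fps_nth (p_fps p c) n * z ^ n) sums f z" if "z \<in> \<D>" for z
    using p_fps_sums[of c p z "f z - z ^ p"] that assms by (simp add: p_expansion_def)
  then show "\<forall>\<^sub>F z in nhds 0. (\<lambda>n. fps_nth (p_fps p c) n * z ^ n) sums f z"
    using eventually_nhds_in_open[of \<D> 0] by (auto elim!: eventually_mono)
qed

text \<open>
  The Taylor series of \<open>f\<close> converges absolutely at \<open>C * z\<close> when \<open>\<bar>z\<bar> < 1 / C\<close>, and it dominates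
  the series with multipliers \<open>d\<close> at \<open>z\<close>.
\<close>
lemma weighted_series_has_fps_expansion:
  assumes holf: "f holomorphic_on \<D>" and C: "C > 0" and d: "\<And>n. norm (d n) \<le> C ^ n"
  shows "(\<lambda>z. z ^ p + (\<Sum>n. d (Suc n + p) * coef f (Suc n + p) * z ^ (Suc n + p)))
           has_fps_expansion p_fps p (\<lambda>n. d n * coef f n)"
proof (rule has_fps_expansionI)
  have "(\<lambda>n. fps_nth (p_fps p (\<lambda>n. d n * coef f n)) n * z ^ n) sums
          (z ^ p + (\<Sum>n. d (Suc n + p) * coef f (Suc n + p) * z ^ (Suc n + p)))"
    if z: "z \<in> ball 0 (1 / C)" for z
  proof -
    have Cz: "norm (of_real C * z) < 1"
      using z C by (simp add: norm_mult field_simps)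
    have rad: "fps_conv_radius (fps_expansion f 0) \<ge> 1"
      using conv_radius_fps_expansion[of f 0 1] holf by (simp add: one_ereal_def)
    have "ereal (norm (of_real C * z)) < fps_conv_radius (fps_expansion f 0)"
      using Cz rad by (intro less_le_trans[OF _ rad]) (simp add: one_ereal_def)
    then have "summable (\<lambda>n. norm (coef f n * (of_real C * z) ^ n))"
      by (rule norm_summable_fps)
    then have "summable (\<lambda>n. d n * coef f n * z ^ n)"
    proof (rule summable_comparison_test[rotated], intro exI[of _ 0] allI impI)
      fix n :: nat
      have "norm (d n) * (norm (coef f n) * norm z ^ n) \<le> C ^ n * (norm (coef f n) * norm z ^ n)"
        by (intro mult_right_mono d) auto
      then show "norm (d n * coef f n * z ^ n) \<le> norm (coef f n * (of_real C * z) ^ n)"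
        using C by (simp add: norm_mult norm_power power_mult_distrib mult_ac)
    qed
    then have "summable (\<lambda>n. d (n + Suc p) * coef f (n + Suc p) * z ^ (n + Suc p))"
      by (subst summable_iff_shift)
    then show ?thesis
      by (intro p_fps_sums summable_sums) simp
  qed
  then show "\<forall>\<^sub>F z in nhds 0. (\<lambda>n. fps_nth (p_fps p (\<lambda>n. d n * coef f n)) n * z ^ n) sums
          (z ^ p + (\<Sum>n. d (Suc n + p) * coef f (Suc n + p) * z ^ (Suc n + p)))"
    using eventually_nhds_in_open[of "ball 0 (1 / C)" 0] C by (auto elim!: eventually_mono)
qed

lemma mult_nth_above_order:
  fixes G W :: "complex fps"
  assumes "\<And>i. i < p \<Longrightarrow> fps_nth G i = 0" and "fps_nth W 0 = 0"
  shows "fps_nth (G * W) (p + 1) = fps_nth G p * fps_nth W 1"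
    and "fps_nth (G * W) (p + 2) = fps_nth G (p + 1) * fps_nth W 1 + fps_nth G p * fps_nth W 2"
proof -
  have tail: "fps_nth (G * W) (p + k) = (\<Sum>i=p..p+k. fps_nth G i * fps_nth W (p + k - i))" for k
    unfolding fps_mult_nth using assms(1) by (intro sum.mono_neutral_right) auto
  show "fps_nth (G * W) (p + 1) = fps_nth G p * fps_nth W 1"
    using tail[of 1] assms(2) by simp
  show "fps_nth (G * W) (p + 2) = fps_nth G (p + 1) * fps_nth W 1 + fps_nth G p * fps_nth W 2"
    using tail[of 2] assms(2) by (simp add: numeral_2_eq_2)
qed

section \<open>\<open>q\<close>-numbers and the \<open>q\<close>-operators on power series\<close>

lemma qnum_strict_mono:
  assumes "0 < q" "q < 1" "x < y"
  shows "qnum q x < qnum q y"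
  using assms by (simp add: qnum_def divide_strict_right_mono powr_less_mono')

lemma qnum_pos:
  assumes "0 < q" "q < 1" "0 < x"
  shows "0 < qnum q x"
  using qnum_strict_mono[OF assms] assms by (simp add: qnum_def)

lemma Lam_pos:
  assumes "0 < q" "q < 1" "\<mu> > -1"
  shows "0 < Lam q \<mu> m"
  unfolding Lam_def qpoch_def qfact_def using assms
  by (intro divide_pos_pos prod_pos qnum_pos ballI) auto

text \<open>
  Each factor \<open>[\<mu> + k, q] / [k, q]\<close> has numerator at most \<open>1 / (1 - q)\<close>, the limit of \<open>[x, q]\<close>
  for large \<open>x\<close>, and denominator at least \<open>[1, q] = 1\<close>. The bound is crude, but a positive radius
  of convergence is all it has to give.
\<close>
lemma Lam_le_power:
  assumes q: "0 < q" "q < 1" and \<mu>: "\<mu> > -1"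
  shows "Lam q \<mu> m \<le> (1 / (1 - q)) ^ m"
proof -
  have "Lam q \<mu> m = (\<Prod>k<m. qnum q (\<mu> + 1 + real k) / qnum q (real (Suc k)))"
    unfolding Lam_def qpoch_def qfact_def
    by (simp add: prod_dividef prod.atLeast1_atMost_eq)
  also have "\<dots> \<le> (\<Prod>k<m. 1 / (1 - q))"
  proof (intro prod_mono conjI)
    fix k
    have pos: "0 < qnum q (\<mu> + 1 + real k)" "0 < qnum q (real (Suc k))"
      using q \<mu> by (auto intro!: qnum_pos)
    then show "0 \<le> qnum q (\<mu> + 1 + real k) / qnum q (real (Suc k))" by simp
    have "1 = qnum q 1" using q by (simp add: qnum_def)
    also have "\<dots> \<le> qnum q (real (Suc k))"
      using q qnum_strict_mono[OF q, of 1 "real (Suc k)"] by (cases k) auto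
    finally have "1 \<le> qnum q (real (Suc k))" .
    moreover have "qnum q (\<mu> + 1 + real k) \<le> 1 / (1 - q)"
      using q by (simp add: qnum_def divide_right_mono)
    ultimately show "qnum q (\<mu> + 1 + real k) / qnum q (real (Suc k)) \<le> 1 / (1 - q)"
      using pos q frac_le[of "1 / (1 - q)" "qnum q (\<mu> + 1 + real k)" 1 "qnum q (real (Suc k))"]
      by simp
  qed
  finally show ?thesis by simp
qed

lemma qderiv_has_fps_expansion:
  assumes q: "0 < q" "q < 1" and G: "g has_fps_expansion G"
  shows "(\<lambda>z. z * qderiv q g z) has_fps_expansion Abs_fps (\<lambda>n. of_real (qnum q (real n)) * fps_nth G n)"
proof -
  define c :: complex where "c = 1 / (1 - of_real q)"
  have "(\<lambda>z. of_real q * z) has_fps_expansion fps_const (of_real q :: complex) * fps_X"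
    by (intro fps_expansion_intros)
  from has_fps_expansion_compose[OF G this]
  have "(\<lambda>z. g (of_real q * z)) has_fps_expansion fps_compose G (fps_const (of_real q) * fps_X)"
    by (simp add: o_def)
  then have "(\<lambda>z. c * (g z - g (of_real q * z))) has_fps_expansion
      fps_const c * (G - fps_compose G (fps_const (of_real q) * fps_X))"
    by (intro fps_expansion_intros G)
  moreover have "(\<lambda>z. c * (g z - g (of_real q * z))) = (\<lambda>z. z * qderiv q g z)"
    by (auto simp: fun_eq_iff qderiv_def c_def)
  moreover have "fps_const c * (G - fps_compose G (fps_const (of_real q) * fps_X))
      = Abs_fps (\<lambda>n. of_real (qnum q (real n)) * fps_nth G n)"
    using q by (intro fps_ext)
      (simp add: c_def qnum_def powr_realpow left_diff_distrib)
  ultimately show ?thesis by simp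
qed

lemma L_op_has_fps_expansion:
  assumes "0 < q" "q < 1" "\<mu> > -1" "f holomorphic_on \<D>"
  shows "L_op p q \<mu> f has_fps_expansion p_fps p (\<lambda>n. of_real (Lam q \<mu> n) * coef f n)"
proof -
  have "norm (of_real (Lam q \<mu> n) :: complex) \<le> (1 / (1 - q)) ^ n" for n
    using Lam_le_power[of q \<mu> n] Lam_pos[of q \<mu> n] assms by simp
  from weighted_series_has_fps_expansion[OF assms(4) _ this, of p] assms show ?thesis
    by (simp add: L_op_def[abs_def])
qed

lemma q_bernardi_has_fps_expansion:
  assumes q: "0 < q" "q < 1" and \<eta>: "\<eta> > - real p" and holf: "f holomorphic_on \<D>"
  shows "q_bernardi p q \<eta> f has_fps_expansion
    p_fps p (\<lambda>n. of_real (qnum q (\<eta> + real p) / qnum q (\<eta> + real n)) * coef f n)"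
proof -
  \<comment> \<open>Below \<open>p\<close> the quotients of \<open>q\<close>-numbers may exceed \<open>1\<close> or have a zero denominator; these
    indices do not enter the series, so the multiplier is set to \<open>0\<close> there.\<close>
  define d :: "nat \<Rightarrow> complex" where
    "d n = (if n < p then 0 else of_real (qnum q (\<eta> + real p) / qnum q (\<eta> + real n)))" for n
  have "norm (d n) \<le> 1 ^ n" for n
  proof (cases "n < p")
    case False
    have "0 < qnum q (\<eta> + real p)" using q \<eta> by (intro qnum_pos) auto
    moreover have "qnum q (\<eta> + real p) \<le> qnum q (\<eta> + real n)"
      using False qnum_strict_mono[OF q, of "\<eta> + real p" "\<eta> + real n"] by (cases "n = p") auto
    ultimately show ?thesis using False by (simp add: d_def norm_divide)
  qed (simp add: d_def)
  from weighted_series_has_fps_expansion[OF holf zero_less_one this, of p]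
  have "q_bernardi p q \<eta> f has_fps_expansion p_fps p (\<lambda>n. d n * coef f n)"
    by (simp add: q_bernardi_def[abs_def] d_def add_ac)
  moreover have "p_fps p (\<lambda>n. d n * coef f n)
    = p_fps p (\<lambda>n. of_real (qnum q (\<eta> + real p) / qnum q (\<eta> + real n)) * coef f n)"
    by (simp add: fps_eq_iff p_fps_nth d_def)
  ultimately show ?thesis by simp
qed

section \<open>Comparing coefficients in the subordination\<close>

text \<open>
  Subtracting \<open>[p,q] g\<close> from both sides of \<open>z \<partial>\<^sub>q g (1 + B w) = [p,q] g (1 + A w)\<close> leaves
  \<open>([m,q] - [p,q]) g\<^sub>m\<close> on the left, up to terms containing \<open>w\<close>; the factor \<open>[m,q] - [p,q]\<close> is
  \<open>[p,q]\<close> divided by \<open>psi p q (m - p)\<close>. In degree \<open>p + 2\<close> the cross term \<open>g\<^sub>1 w\<^sub>1\<close> contributes the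
  summand \<open>(A - B) \<psi>\<^sub>1 w\<^sub>1\<^sup>2\<close>.
\<close>
lemma coefficients_from_subordination:
  assumes q: "0 < q" "q < 1" and p: "p \<ge> 1"
    and AB: "-1 \<le> B" "B \<le> 1" "-1 \<le> A" "A \<le> 1"
    and G: "g has_fps_expansion p_fps p c"
    and holw: "w holomorphic_on \<D>" and w0: "w 0 = 0"
    and w_lt: "\<And>z. norm z < 1 \<Longrightarrow> norm (w z) < 1"
    and quot: "\<And>z. \<lbrakk>norm z < 1; z \<noteq> 0\<rbrakk> \<Longrightarrow> z * qderiv q g z / (of_real (qnum q (real p)) * g z)
                 = (1 + of_real A * w z) / (1 + of_real B * w z)"
  shows "c (p + 1) = of_real ((A - B) * psi p q 1) * coef w 1"
    and "c (p + 2) = of_real ((A - B) * psi p q 2)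
           * (coef w 2 - of_real (B - (A - B) * psi p q 1) * (coef w 1)\<^sup>2)"
proof -
  define G W where "G = p_fps p c" and "W = fps_expansion w 0"
  define D where "D = Abs_fps (\<lambda>n. of_real (qnum q (real n)) * fps_nth G n)"
  let ?p = "of_real (qnum q (real p)) :: complex"
  have near: "\<forall>\<^sub>F z in nhds (0::complex). norm z < 1"
    using eventually_nhds_in_open[of \<D> 0] by simp
  have G': "g has_fps_expansion G" using G by (simp add: G_def)
  have W: "w has_fps_expansion W"
    unfolding W_def using has_fps_expansion_fps_expansion[of \<D> w] holw by simp
  have D: "(\<lambda>z. z * qderiv q g z) has_fps_expansion D"
    unfolding D_def by (rule qderiv_has_fps_expansion[OF q G'])
  have W0: "fps_nth W 0 = 0" using w0 by (simp add: W_def fps_expansion_def)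
  have g0: "g 0 = 0"
    using has_fps_expansion_imp_0_eq_fps_nth_0[OF G'] p by (simp add: G_def p_fps_nth)
  have nz: "1 + of_real r * w z \<noteq> 0" if "norm z < 1" "-1 \<le> r" "r \<le> 1" for r z
  proof
    assume "1 + of_real r * w z = 0"
    then have "of_real r * w z = -1" by (simp add: add_eq_0_iff)
    then have "\<bar>r\<bar> * norm (w z) = 1" by (metis norm_minus_cancel norm_mult norm_of_real norm_one)
    moreover have "\<bar>r\<bar> * norm (w z) \<le> 1 * norm (w z)"
      using that by (intro mult_right_mono) auto
    ultimately show False using w_lt[OF that(1)] by simp
  qed
  have "(z * qderiv q g z) * (1 + of_real B * w z) = ?p * g z * (1 + of_real A * w z)"
    if z: "norm z < 1" for z
  proof (cases "z = 0")
    case False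
    have "(1 + of_real A * w z) / (1 + of_real B * w z) \<noteq> 0"
      using nz[OF z] AB by simp
    \<comment> \<open>A zero of \<open>g\<close> would make the left quotient \<open>0\<close> by the convention for division by \<open>0\<close>, while
      the right one never vanishes.\<close>
    then have "?p * g z \<noteq> 0" using quot[OF z False] by (metis div_by_0)
    then show ?thesis using quot[OF z False] nz[OF z, of B] AB by (simp add: frac_eq_eq mult_ac)
  qed (simp add: g0)
  then have "\<forall>\<^sub>F z in nhds 0. (z * qderiv q g z) * (1 + of_real B * w z) = ?p * g z * (1 + of_real A * w z)"
    using near by (auto elim!: eventually_mono)
  moreover have "(\<lambda>z. (z * qderiv q g z) * (1 + of_real B * w z)) has_fps_expansion
      D * (1 + fps_const (of_real B) * W)"
    by (intro fps_expansion_intros D W)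
  moreover have "(\<lambda>z. ?p * g z * (1 + of_real A * w z)) has_fps_expansion
      fps_const ?p * G * (1 + fps_const (of_real A) * W)"
    by (intro fps_expansion_intros G' W)
  ultimately have eq: "D * (1 + fps_const (of_real B) * W) = fps_const ?p * G * (1 + fps_const (of_real A) * W)"
    using has_fps_expansion_cong[OF _ refl, of "\<lambda>z. (z * qderiv q g z) * (1 + of_real B * w z)"
        "\<lambda>z. ?p * g z * (1 + of_real A * w z)"]
    by (meson fps_expansion_unique_complex)
  have coeffs: "fps_nth D n + of_real B * fps_nth (D * W) n
      = ?p * (fps_nth G n + of_real A * fps_nth (G * W) n)" for n
  proof -
    have "D + fps_const (of_real B) * (D * W) = fps_const ?p * (G + fps_const (of_real A) * (G * W))"
      using eq by (simp add: algebra_simps)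
    then have "fps_nth (D + fps_const (of_real B) * (D * W)) n
        = fps_nth (fps_const ?p * (G + fps_const (of_real A) * (G * W))) n" by simp
    then show ?thesis by simp
  qed
  have Dn: "fps_nth D n = of_real (qnum q (real n)) * fps_nth G n" for n
    by (simp add: D_def)
  have Gn: "i < p \<Longrightarrow> fps_nth G i = 0" "fps_nth G p = 1"
      "fps_nth G (p + 1) = c (p + 1)" "fps_nth G (p + 2) = c (p + 2)" for i
    by (simp_all add: G_def p_fps_nth)
  note mult_G = mult_nth_above_order[of p G W, OF Gn(1) W0]
  note mult_D = mult_nth_above_order[of p D W, OF _ W0]
  define x y1 y2 where "x = qnum q (real p)"
    and "y1 = qnum q (real (1 + p))" and "y2 = qnum q (real (2 + p))"
  have x: "x > 0" and y1: "y1 > x" and y2: "y2 > x"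
    unfolding x_def y1_def y2_def using q p by (auto intro!: qnum_pos qnum_strict_mono)
  have psi: "psi p q 1 = x / (y1 - x)" "psi p q 2 = x / (y2 - x)"
    by (simp_all add: psi_def x_def y1_def y2_def)
  define u where "u = c (p + 1)"
  define v where "v = c (p + 2)"
  define w1 where "w1 = coef w 1"
  define w2 where "w2 = coef w 2"
  have e1: "of_real y1 * u + of_real B * (of_real x * w1) = of_real x * (u + of_real A * w1)"
    using coeffs[of "p + 1"] mult_G(1) mult_D(1) Gn
    by (simp add: Dn u_def w1_def W_def x_def y1_def add.commute)
  have e2: "of_real y2 * v + of_real B * (of_real y1 * u * w1 + of_real x * w2)
      = of_real x * (v + of_real A * (u * w1 + w2))"
    using coeffs[of "p + 2"] mult_G(2) mult_D(2) Gn
    by (simp add: Dn u_def v_def w1_def w2_def W_def x_def y1_def y2_def add.commute)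
  have ne: "(of_real y1 - of_real x :: complex) \<noteq> 0" "(of_real y2 - of_real x :: complex) \<noteq> 0"
    using y1 y2 by (simp_all flip: of_real_diff)
  have u: "u = of_real (A - B) * (of_real x / (of_real y1 - of_real x)) * w1"
    using e1 ne(1) by (simp add: field_simps)
  then show "c (p + 1) = of_real ((A - B) * psi p q 1) * coef w 1"
    unfolding psi u_def w1_def by simp
  have uy: "u * (of_real y1 - of_real x) = of_real (A - B) * of_real x * w1"
    using u ne(1) by (simp add: field_simps)
  have "v * (of_real y2 - of_real x)
      = of_real x * of_real (A - B) * (w2 + u * w1) - of_real B * w1 * (u * (of_real y1 - of_real x))"
    using e2 by (simp add: algebra_simps)
  \<comment> \<open>The relation in degree \<open>p + 1\<close> turns the cross term with \<open>B\<close> into a multiple of \<open>w1\<^sup>2\<close>.\<close>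
  also have "\<dots> = of_real x * of_real (A - B) * (w2 + u * w1 - of_real B * w1\<^sup>2)"
    unfolding uy by (simp add: algebra_simps power2_eq_square)
  finally have "v = of_real (A - B) * (of_real x / (of_real y2 - of_real x))
      * (w2 + u * w1 - of_real B * w1\<^sup>2)"
    using ne(2) by (simp add: field_simps)
  then show "c (p + 2) = of_real ((A - B) * psi p q 2)
           * (coef w 2 - of_real (B - (A - B) * psi p q 1) * (coef w 1)\<^sup>2)"
    unfolding u v_def[symmetric] w1_def[symmetric] w2_def[symmetric] psi
    by (simp add: algebra_simps power2_eq_square)
qed

section \<open>The Fekete--Szego inequality for the Bernardi integral\<close>

theorem theorem3p9:
  fixes p :: nat and q \<mu> A B \<eta> :: real
    and f :: "complex \<Rightarrow> complex" and a b :: "nat \<Rightarrow> complex" and \<sigma> :: complex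
  assumes "p \<ge> 1" and "0 < q" and "q < 1" and "\<mu> > -1"
    and "-1 \<le> B" and "B < A" and "A \<le> 1" and "\<eta> > - real p"
    and "f \<in> class_S p q \<mu> A B"
    and "p_expansion p a f"
    and "p_expansion p b (q_bernardi p q \<eta> f)"
  shows "let \<upsilon> = of_real (B - (A - B) * psi p q 1)
           + of_real (Lam q \<mu> (p + 2) * (psi p q 1)\<^sup>2 / ((Lam q \<mu> (p + 1))\<^sup>2 * psi p q 2)
               * (A - B)
               * (qnum q (\<eta> + real p) * qnum q (\<eta> + real p + 2) / (qnum q (\<eta> + real p + 1))\<^sup>2))
             * \<sigma>
         in cmod (b (p + 2) - \<sigma> * (b (p + 1))\<^sup>2)
              \<le> qnum q (\<eta> + real p) / qnum q (\<eta> + real p + 2)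
                 * ((A - B) * psi p q 2 / Lam q \<mu> (p + 2)) * max 1 (cmod \<upsilon>)"
proof -
  note q = assms(2,3)
  have holf: "f holomorphic_on \<D>"
    using assms(9) by (simp add: class_S_def class_A_def)
  obtain w where holw: "w holomorphic_on \<D>" and w0: "w 0 = 0"
    and w_ball: "\<forall>z\<in>\<D>. norm (w z) < 1"
    and quot_ball: "\<forall>z\<in>\<D>. (if z = 0 then 1
        else z * qderiv q (L_op p q \<mu> f) z / (of_real (qnum q (real p)) * L_op p q \<mu> f z))
          = (1 + of_real A * w z) / (1 + of_real B * w z)"
    using assms(9) unfolding class_S_def subordinate_def by blast
  have w_lt: "norm (w z) < 1" if "norm z < 1" for z
    using w_ball that by simp
  have quot: "z * qderiv q (L_op p q \<mu> f) z / (of_real (qnum q (real p)) * L_op p q \<mu> f z)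
      = (1 + of_real A * w z) / (1 + of_real B * w z)" if "norm z < 1" "z \<noteq> 0" for z
    using bspec[OF quot_ball, of z] that by simp
  define L1 L2 P1 P2 Q0 Q1 Q2 where "L1 = Lam q \<mu> (p + 1)" and "L2 = Lam q \<mu> (p + 2)"
    and "P1 = psi p q 1" and "P2 = psi p q 2" and "Q0 = qnum q (\<eta> + real p)"
    and "Q1 = qnum q (\<eta> + real p + 1)" and "Q2 = qnum q (\<eta> + real p + 2)"
  note fold_names = L1_def[symmetric] L2_def[symmetric] P1_def[symmetric] P2_def[symmetric]
    Q0_def[symmetric] Q1_def[symmetric] Q2_def[symmetric]
  have L: "L1 > 0" "L2 > 0" unfolding L1_def L2_def using q assms(4) by (auto intro!: Lam_pos)
  have Q: "Q0 > 0" "Q1 > 0" "Q2 > 0"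
    unfolding Q0_def Q1_def Q2_def using q assms(8) by (auto intro!: qnum_pos)
  have P: "P2 > 0"
    unfolding P2_def psi_def using q assms(1)
    by (intro divide_pos_pos) (auto intro!: qnum_pos qnum_strict_mono)
  define w1 w2 where "w1 = coef w 1" and "w2 = coef w 2"
  have AB: "B \<le> 1" "-1 \<le> A" using assms(5,6,7) by auto
  note coeffs = coefficients_from_subordination[OF q assms(1,5) AB assms(7)
      L_op_has_fps_expansion[OF q assms(4) holf] holw w0]
  have a1: "of_real L1 * coef f (p + 1) = of_real ((A - B) * P1) * w1"
    unfolding L1_def P1_def w1_def using w_lt quot by (rule coeffs(1))
  have a2: "of_real L2 * coef f (p + 2)
      = of_real ((A - B) * P2) * (w2 - of_real (B - (A - B) * P1) * w1\<^sup>2)"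
    unfolding L2_def P1_def P2_def w1_def w2_def using w_lt quot by (rule coeffs(2))
  have "p_fps p b = p_fps p (\<lambda>n. of_real (qnum q (\<eta> + real p) / qnum q (\<eta> + real n)) * coef f n)"
    using fps_expansion_unique_complex p_expansion_imp_has_fps_expansion[OF assms(11)]
      q_bernardi_has_fps_expansion[OF q assms(8) holf] by blast
  then have "b n = of_real (qnum q (\<eta> + real p) / qnum q (\<eta> + real n)) * coef f n" if "n > p" for n
    using that by (auto simp: fps_eq_iff p_fps_nth split: if_splits dest: spec[of _ n])
  from this[of "p + 1"] this[of "p + 2"]
  have b: "b (p + 1) = of_real (Q0 / Q1) * coef f (p + 1)"
    "b (p + 2) = of_real (Q0 / Q2) * coef f (p + 2)"
    by (simp_all add: Q0_def Q1_def Q2_def add_ac)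
  have solve: "x = of_real (c / l) * y" if "of_real l * x = of_real c * y" "l > 0"
    for x y :: complex and c l :: real
    using that by (simp add: field_simps)
  have b1: "b (p + 1) = of_real (Q0 / Q1 * ((A - B) * P1 / L1)) * w1"
    unfolding b solve[OF a1 L(1)] by (simp only: of_real_mult mult.assoc)
  have b2: "b (p + 2) = of_real (Q0 / Q2 * ((A - B) * P2 / L2))
      * (w2 - of_real (B - (A - B) * P1) * w1\<^sup>2)"
    unfolding b solve[OF a2 L(2)] by (simp only: of_real_mult mult.assoc)
  define \<upsilon> where "\<upsilon> = of_real (B - (A - B) * P1)
      + of_real (L2 * P1\<^sup>2 / (L1\<^sup>2 * P2) * (A - B) * (Q0 * Q2 / Q1\<^sup>2)) * \<sigma>"
  define K where "K = Q0 / Q2 * ((A - B) * P2 / L2)"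
  have K: "K \<ge> 0" unfolding K_def using Q P L assms(6) by simp
  \<comment> \<open>The factor beside \<open>K\<close> is the coefficient of \<open>\<sigma>\<close> in \<open>\<upsilon>\<close>.\<close>
  have "(Q0 / Q1 * ((A - B) * P1 / L1))\<^sup>2
      = K * (L2 * P1\<^sup>2 / (L1\<^sup>2 * P2) * (A - B) * (Q0 * Q2 / Q1\<^sup>2))"
    unfolding K_def using Q P L by (simp add: field_simps power2_eq_square)
  then have "(b (p + 1))\<^sup>2
      = of_real (K * (L2 * P1\<^sup>2 / (L1\<^sup>2 * P2) * (A - B) * (Q0 * Q2 / Q1\<^sup>2))) * w1\<^sup>2"
    unfolding b1 by (simp only: power_mult_distrib flip: of_real_power)
  then have "b (p + 2) - \<sigma> * (b (p + 1))\<^sup>2 = of_real K * (w2 - \<upsilon> * w1\<^sup>2)"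
    unfolding b2 K_def[symmetric] \<upsilon>_def by (simp only: of_real_mult) (simp add: algebra_simps)
  then have "cmod (b (p + 2) - \<sigma> * (b (p + 1))\<^sup>2) = K * cmod (w2 - \<upsilon> * w1\<^sup>2)"
    using K by (simp add: norm_mult)
  also have "\<dots> \<le> K * max 1 (cmod \<upsilon>)"
    unfolding w1_def w2_def
    by (intro mult_left_mono K Schwarz_function_Fekete_Szego holw w0 w_lt)
  finally show ?thesis
    unfolding Let_def fold_names K_def \<upsilon>_def .
qed

end
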